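(* (a) If $\mathcal A\subseteq\mathcal M$ is weakly unitarily invariant, then for every $\Delta\in\mathcal M^{\geq}$ with eigenvalues $\lambda_1\geq\ldots\geq\lambda_n$ one has $$\iota(\Delta;\mathcal A)=g_{\mathcal A}(\lambda_1,\ldots,\lambda_n).\qquad( * )$$ (b) Conversely, if $\mathcal A$ is a non-empty subset of $\mathcal M$ such that $( * )$ holds for every $\Delta\in\mathcal M^{\geq}$, then there exists a unitarily invariant set $\mathcal A'\subseteq\mathcal M$ such that $\iota(\Delta;\mathcal A)=\iota(\Delta;\mathcal A')$ for all $\Delta\in\mathcal M^{\geq}$.
   Context: $n$ is a positive integer, $\mathcal M$ is the algebra of complex $n\times n$ matrices, $\mathcal U$ the set of unitary matrices in $\mathcal M$, $\mathcal M^{\geq}$ the cone of non-negative Hermitian matrices in $\mathcal M$. For a non-empty $\mathcal A\subseteq\mathcal M$ and $\Delta\in\mathcal M^{\geq}$, $\iota(\Delta;\mathcal A)=\inf\{\mathrm{tr}(A\Delta A^* ):A\in\mathcal A\}$. $\mathcal D=\{(x_1,\ldots,x_n)^\top\in[0,+\infty)^n:x_1\geq\ldots\geq x_n\}$, and $g_{\mathcal A}(x_1,\ldots,x_n)=\iota(\mathrm{diag}(x_1,\ldots,x_n);\mathcal A)$ for $(x_1,\ldots,x_n)^\top\in\mathcal D$. A non-empty set $\mathcal A\subseteq\mathcal M$ is called right unitarily invariant if $\mathcal AU=\mathcal A$ for all $U\in\mathcal U$; unitary similarity invariant if $U^*\mathcal AU=\mathcal A$ for all $U\in\mathcal U$;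 unitarily invariant if $V\mathcal AU=\mathcal A$ for all $U,V\in\mathcal U$; weakly unitarily invariant if it is right unitarily invariant or unitary similarity invariant. *)

theory Defs
  imports "Jordan_Normal_Form.Char_Poly" "Jordan_Normal_Form.Schur_Decomposition"
begin

text \<open>The algebra of complex \<open>n \<times> n\<close> matrices is \<^term>\<open>carrier_mat n n :: complex mat set\<close>;
  indices run over \<open>0, \<dots>, n - 1\<close>.\<close>

definition unitary_mats :: "nat \<Rightarrow> complex mat set" where
  "unitary_mats n =
    {U \<in> carrier_mat n n. mat_adjoint U * U = 1\<^sub>m n \<and> U * mat_adjoint U = 1\<^sub>m n}"

text \<open>The quadratic form of a Hermitian matrix takes real values, so \<^const>\<open>Re\<close> loses nothing.\<close>

definition nonneg_hermitian_mats :: "nat \<Rightarrow> complex mat set" where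
  "nonneg_hermitian_mats n =
    {\<Delta> \<in> carrier_mat n n. mat_adjoint \<Delta> = \<Delta> \<and>
       (\<forall>v \<in> carrier_vec n. 0 \<le> Re ((\<Delta> *\<^sub>v v) \<bullet>c v))}"

definition mat_trace :: "complex mat \<Rightarrow> complex" where
  "mat_trace A = (\<Sum>i<dim_row A. A $$ (i, i))"

text \<open>For a non-negative Hermitian \<open>\<Delta>\<close> the traces below are real and non-negative, so for
  non-empty \<open>\<A>\<close> this is a genuine infimum of a set bounded below. For empty \<open>\<A>\<close> the value is
  a junk value.\<close>

definition iota :: "complex mat \<Rightarrow> complex mat set \<Rightarrow> real" where
  "iota \<Delta> \<A> = (INF A\<in>\<A>. Re (mat_trace (A * \<Delta> * mat_adjoint A)))"

definition real_diag :: "real vec \<Rightarrow> complex mat" where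
  "real_diag x = mat_diag (dim_vec x) (\<lambda>i. complex_of_real (x $ i))"

text \<open>This function is only meant to be applied to \<open>x\<close> with non-negative, non-increasing
  entries.\<close>

definition g_fun :: "complex mat set \<Rightarrow> real vec \<Rightarrow> real" where
  "g_fun \<A> x = iota (real_diag x) \<A>"

text \<open>The entries of \<open>x\<close> are the eigenvalues of \<open>\<Delta>\<close>, listed with algebraic multiplicity in
  non-increasing order. For non-negative Hermitian \<open>\<Delta>\<close> exactly one such \<open>x\<close> exists, and its
  entries are non-negative.\<close>

definition ordered_eigenvalues :: "complex mat \<Rightarrow> real vec \<Rightarrow> bool" where
  "ordered_eigenvalues \<Delta> x \<longleftrightarrow>
     dim_vec x = dim_row \<Delta> \<and>
     (\<forall>i j. i \<le> j \<longrightarrow> j < dim_vec x \<longrightarrow> x $ j \<le> x $ i) \<and>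
     char_poly \<Delta> = (\<Prod>i<dim_vec x. [:- complex_of_real (x $ i), 1:])"

definition right_unitarily_invariant :: "nat \<Rightarrow> complex mat set \<Rightarrow> bool" where
  "right_unitarily_invariant n \<A> \<longleftrightarrow> \<A> \<noteq> {} \<and> \<A> \<subseteq> carrier_mat n n \<and>
     (\<forall>U \<in> unitary_mats n. (\<lambda>A. A * U) ` \<A> = \<A>)"

definition unitary_similarity_invariant :: "nat \<Rightarrow> complex mat set \<Rightarrow> bool" where
  "unitary_similarity_invariant n \<A> \<longleftrightarrow> \<A> \<noteq> {} \<and> \<A> \<subseteq> carrier_mat n n \<and>
     (\<forall>U \<in> unitary_mats n. (\<lambda>A. mat_adjoint U * A * U) ` \<A> = \<A>)"

definition unitarily_invariant :: "nat \<Rightarrow> complex mat set \<Rightarrow> bool" where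
  "unitarily_invariant n \<A> \<longleftrightarrow> \<A> \<noteq> {} \<and> \<A> \<subseteq> carrier_mat n n \<and>
     (\<forall>U \<in> unitary_mats n. \<forall>V \<in> unitary_mats n. (\<lambda>A. V * A * U) ` \<A> = \<A>)"

definition weakly_unitarily_invariant :: "nat \<Rightarrow> complex mat set \<Rightarrow> bool" where
  "weakly_unitarily_invariant n \<A> \<longleftrightarrow>
     right_unitarily_invariant n \<A> \<or> unitary_similarity_invariant n \<A>"

end

theory Submission
  imports Defs
begin

text \<open>Write \<open>\<tau>(A, \<Delta>) = tr (A \<Delta> A\<^sup>*)\<close>. Everything rests on two symmetries of \<open>\<tau>\<close>, for
  unitary \<open>U\<close> and \<open>V\<close>: \<open>\<tau>(A, U \<Delta> U\<^sup>*) = \<tau>(A U, \<Delta>)\<close> by regrouping the product, and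
  \<open>\<tau>(V A, \<Delta>) = \<tau>(A, \<Delta>)\<close> because the trace is cyclic. So conjugating \<open>\<Delta>\<close> amounts to
  multiplying \<open>\<A>\<close> by \<open>U\<close> on the right (\<open>iota_congruence\<close>), whereas left unitary factors on
  \<open>\<A>\<close> are invisible to the infimum (\<open>iota_unitary_left\<close>).

  For the direct part, a Hermitian \<open>\<Delta>\<close> is \<open>U D U\<^sup>*\<close> with \<open>D\<close> the diagonal matrix of its
  ordered eigenvalues (\<open>ordered_eigenvalues_diagonalise\<close>, from the spectral theorem
  \<open>hermitian_spectral\<close>). The infima for \<open>\<Delta>\<close> and \<open>D\<close> over \<open>\<A>\<close> agree
  (\<open>weakly_unitarily_invariant_iota\<close>): if \<open>\<A>\<close> is right unitarily invariant then \<open>\<A> U = \<A>\<close>,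
  and if it is unitary similarity invariant then \<open>\<A> U\<close> differs from \<open>U\<^sup>* \<A> U = \<A>\<close> only by
  a left factor.

  For the converse, take \<open>\<A>'\<close> to be the set of all \<open>V A U\<close> with \<open>A \<in> \<A>\<close>. By the symmetries,
  the values of \<open>\<tau>(\<cdot>, \<Delta>)\<close> on \<open>\<A>'\<close> are exactly the values of \<open>\<tau>(\<cdot>, U \<Delta> U\<^sup>*)\<close> on \<open>\<A>\<close> as \<open>U\<close>
  varies. Since \<open>U \<Delta> U\<^sup>*\<close> has the same eigenvalues as \<open>\<Delta>\<close>, the hypothesis gives each of them
  the same infimum over \<open>\<A>\<close>, so passing to \<open>\<A>'\<close> does not lower the infimum
  (\<open>iota_unitary_hull\<close>). This uses that ordered eigenvalues exist
  (\<open>ordered_eigenvalues_exist\<close>) and that the traces are bounded below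
  (\<open>nonneg_hermitian_trace\<close>), without which the infimum of real numbers is meaningless.\<close>

section \<open>Adjoints\<close>

text \<open>With a single dimension \<open>n\<close> the carrier premises contain no intermediate dimension to be
  guessed, so the simplifier can discharge them.\<close>

lemma square_mult_carrier [simp]:
  "A \<in> carrier_mat n n \<Longrightarrow> B \<in> carrier_mat n n \<Longrightarrow> A * B \<in> carrier_mat n n"
  by (rule mult_carrier_mat)

lemma square_mult_assoc:
  "A \<in> carrier_mat n n \<Longrightarrow> B \<in> carrier_mat n n \<Longrightarrow> C \<in> carrier_mat n n \<Longrightarrow>
    A * B * C = A * (B * C)"
  by (rule assoc_mult_mat)

lemma mat_adjoint_dim [simp]:
  "dim_row (mat_adjoint A) = dim_col A" "dim_col (mat_adjoint A) = dim_row A"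
  by (auto simp: mat_adjoint_def)

lemma mat_adjoint_carrier [simp, intro]:
  "A \<in> carrier_mat m n \<Longrightarrow> mat_adjoint A \<in> carrier_mat n m"
  by (auto intro: carrier_matI)

lemma mat_adjoint_index [simp]:
  assumes "i < dim_col A" "j < dim_row A"
  shows "mat_adjoint A $$ (i, j) = conjugate (A $$ (j, i))"
  using assms by (auto simp: mat_adjoint_def mat_of_rows_def)

lemma mat_adjoint_adjoint [simp]: "mat_adjoint (mat_adjoint A) = A"
  by (rule eq_matI) auto

lemma mat_adjoint_one [simp]: "mat_adjoint (1\<^sub>m n :: complex mat) = 1\<^sub>m n"
  by (rule eq_matI) auto

lemma mat_adjoint_mult:
  assumes "A \<in> carrier_mat m k" "B \<in> carrier_mat k n"
  shows "mat_adjoint (A * B) = mat_adjoint B * mat_adjoint A"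
  using assms
  by (intro eq_matI)
     (auto simp: scalar_prod_def sum_conjugate conjugate_dist_mul mult.commute intro!: sum.cong)

lemma mat_adjoint_mult_mat_vec:
  assumes A: "A \<in> carrier_mat m n" and v: "v \<in> carrier_vec n" and w: "w \<in> carrier_vec m"
  shows "(A *\<^sub>v v) \<bullet>c w = v \<bullet>c (mat_adjoint A *\<^sub>v w)"
proof -
  have "(A *\<^sub>v v) \<bullet>c w = (\<Sum>i<m. \<Sum>j<n. A $$ (i, j) * v $ j * conjugate (w $ i))"
    using assms by (auto simp: scalar_prod_def sum_distrib_right atLeast0LessThan intro!: sum.cong)
  also have "\<dots> = (\<Sum>j<n. \<Sum>i<m. A $$ (i, j) * v $ j * conjugate (w $ i))"
    by (rule sum.swap)
  also have "\<dots> = v \<bullet>c (mat_adjoint A *\<^sub>v w)"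
    using assms
    by (auto simp: scalar_prod_def sum_distrib_left atLeast0LessThan sum_conjugate
        conjugate_dist_mul mult_ac intro!: sum.cong)
  finally show ?thesis .
qed

lemma mat_adjoint_mult_index:
  assumes "A \<in> carrier_mat m n" "i < n" "j < n"
  shows "(mat_adjoint A * A) $$ (i, j) = col A j \<bullet>c col A i"
  using assms by (auto simp: scalar_prod_def mult.commute intro!: sum.cong)

section \<open>Unitary matrices\<close>

lemma unitary_matsD:
  assumes "U \<in> unitary_mats n"
  shows "U \<in> carrier_mat n n" "mat_adjoint U * U = 1\<^sub>m n" "U * mat_adjoint U = 1\<^sub>m n"
  using assms by (auto simp: unitary_mats_def)

lemma unitary_matsI:
  assumes "U \<in> carrier_mat n n" "mat_adjoint U * U = 1\<^sub>m n"
  shows "U \<in> unitary_mats n"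
  using assms mat_mult_left_right_inverse[of "mat_adjoint U" n U] by (auto simp: unitary_mats_def)

lemma unitary_mats_one [simp]: "1\<^sub>m n \<in> unitary_mats n"
  by (rule unitary_matsI) auto

lemma unitary_mats_adjoint: "U \<in> unitary_mats n \<Longrightarrow> mat_adjoint U \<in> unitary_mats n"
  by (auto simp: unitary_mats_def)

lemma unitary_cancel_left:
  assumes "U \<in> unitary_mats n" "X \<in> carrier_mat n k"
  shows "mat_adjoint U * (U * X) = X" "U * (mat_adjoint U * X) = X"
  using unitary_matsD[OF assms(1)] assms(2)
  by (simp_all add: assoc_mult_mat[symmetric, of _ n n _ n _ k])

lemma unitary_cancel_right:
  assumes "U \<in> unitary_mats n" "X \<in> carrier_mat k n"
  shows "X * mat_adjoint U * U = X" "X * U * mat_adjoint U = X"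
  using unitary_matsD[OF assms(1)] assms(2)
  by (simp_all add: assoc_mult_mat[of _ k n _ n _ n])

lemma unitary_mats_mult:
  assumes U: "U \<in> unitary_mats n" and V: "V \<in> unitary_mats n"
  shows "U * V \<in> unitary_mats n"
proof (rule unitary_matsI)
  note c = unitary_matsD(1)[OF U] unitary_matsD(1)[OF V]
  show "U * V \<in> carrier_mat n n" using c by auto
  have "mat_adjoint (U * V) * (U * V) = mat_adjoint V * mat_adjoint U * (U * V)"
    using mat_adjoint_mult[OF c] by simp
  also have "\<dots> = mat_adjoint V * (mat_adjoint U * (U * V))"
    using c by (intro assoc_mult_mat[of _ n n _ n _ n]) auto
  also have "\<dots> = 1\<^sub>m n"
    using unitary_cancel_left(1)[OF U c(2)] unitary_matsD[OF V] by simp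
  finally show "mat_adjoint (U * V) * (U * V) = 1\<^sub>m n" .
qed

section \<open>The spectral theorem for Hermitian matrices\<close>

text \<open>Gram-Schmidt on a basis starting with \<open>v\<close> keeps \<open>v\<close> as first vector and yields an orthogonal
  basis; normalising its members gives the columns of \<open>W\<close>, the first of which is a multiple
  of \<open>v\<close>.\<close>

lemma unitary_completion:
  fixes v :: "complex vec"
  assumes v: "v \<in> carrier_vec n" and v0: "v \<noteq> 0\<^sub>v n"
  obtains W c where "W \<in> unitary_mats n" "col W 0 = c \<cdot>\<^sub>v v"
proof -
  interpret cof_vec_space n "TYPE(complex)" .
  define b where "b = basis_completion v"
  define ws where "ws = gram_schmidt n b"
  note b = basis_completion[OF v v0, folded b_def]
  have n0: "n \<noteq> 0" using v v0 by (metis carrier_vecD eq_vecI index_zero_vec(2) less_nat_zero_code)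
  then obtain vs where bv: "b = v # vs" using b by (cases b) auto
  have gs: "corthogonal ws" "set ws \<subseteq> carrier_vec n" "length ws = n"
    using gram_schmidt_result[OF b(2,4,5) refl, folded ws_def] b(6) by auto
  have hd_ws: "ws ! 0 = v"
    using gram_schmidt_hd[OF v, of vs, folded bv] gs(3) n0
    by (simp add: ws_def hd_conv_nth[symmetric] flip: length_greater_0_conv)
  define c where "c w = complex_of_real (1 / sqrt (Re (w \<bullet>c w)))" for w :: "complex vec"
  define W where "W = mat_of_cols n (map (\<lambda>w. c w \<cdot>\<^sub>v w) ws)"
  have W: "W \<in> carrier_mat n n" using gs(3) by (auto simp: W_def)
  have wsi: "ws ! i \<in> carrier_vec n" if "i < n" for i using gs that by (auto simp: subset_iff)
  have col: "col W i = c (ws ! i) \<cdot>\<^sub>v (ws ! i)" if "i < n" for i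
    using that gs(3) wsi unfolding W_def by (subst col_mat_of_cols) auto
  have norm: "c w * c w * (w \<bullet>c w) = 1" if "w \<in> carrier_vec n" "w \<bullet>c w \<noteq> 0" for w
  proof -
    have "w \<bullet>c w > 0" using that by auto
    then have r: "Re (w \<bullet>c w) > 0" "w \<bullet>c w = complex_of_real (Re (w \<bullet>c w))"
      by (auto simp: less_complex_def complex_eq_iff)
    show ?thesis using r(1) by (subst r(2)) (simp add: c_def flip: of_real_mult)
  qed
  have "mat_adjoint W * W = 1\<^sub>m n"
  proof (rule eq_matI)
    fix i j assume "i < dim_row (1\<^sub>m n :: complex mat)" "j < dim_col (1\<^sub>m n :: complex mat)"
    then have ij: "i < n" "j < n" by auto
    have conj_c: "conjugate (c w) = c w" for w by (simp add: c_def)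
    have "(mat_adjoint W * W) $$ (i, j) = col W j \<bullet>c col W i"
      by (rule mat_adjoint_mult_index[OF W ij])
    also have "\<dots> = c (ws ! j) * c (ws ! i) * (ws ! j \<bullet>c ws ! i)"
      using wsi[OF ij(1)] wsi[OF ij(2)]
      by (simp add: col ij conjugate_smult_vec conj_c mult_ac del: conjugate_complex_def)
    also have "\<dots> = 1\<^sub>m n $$ (i, j)"
      using corthogonalD[OF gs(1), of j i] gs(3) ij norm[OF wsi[OF ij(1)]] by auto
    finally show "(mat_adjoint W * W) $$ (i, j) = 1\<^sub>m n $$ (i, j)" .
  qed (use W in auto)
  with W have "W \<in> unitary_mats n" by (rule unitary_matsI)
  then show thesis using that col[of 0] hd_ws n0 by auto
qed

lemma mat_adjoint_congruence:
  assumes "A \<in> carrier_mat n n" "B \<in> carrier_mat n n" "mat_adjoint B = B"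
  shows "mat_adjoint (A * B * mat_adjoint A) = A * B * mat_adjoint A"
  using assms
  by (simp add: mat_adjoint_mult[of _ n n _ n] square_mult_assoc[of _ n])

lemma char_poly_unitary_similar:
  assumes U: "U \<in> unitary_mats n" and A: "A \<in> carrier_mat n n"
  shows "char_poly (U * A * mat_adjoint U) = char_poly A"
proof (rule char_poly_similar)
  have "similar_mat_wit (U * A * mat_adjoint U) A U (mat_adjoint U)"
    using unitary_matsD[OF U] A by (intro similar_mat_witI[of _ _ n]) auto
  then show "similar_mat (U * A * mat_adjoint U) A" unfolding similar_mat_def by blast
qed

text \<open>The induction step of the spectral theorem. If the first column of \<open>W\<close> is an eigenvector
  for \<open>e\<close>, then the first column of \<open>W\<^sup>* A W\<close> is \<open>e\<close> times the first unit vector; since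
  \<open>W\<^sup>* A W\<close> is Hermitian, its first row has the same shape and the matrix splits off the
  block \<open>e\<close>.\<close>

lemma hermitian_deflation:
  fixes A :: "complex mat"
  assumes A: "A \<in> carrier_mat (Suc m) (Suc m)" and herm: "mat_adjoint A = A"
    and e: "poly (char_poly A) e = 0"
  obtains W B where "W \<in> unitary_mats (Suc m)" "B \<in> carrier_mat m m" "mat_adjoint B = B"
    "mat_adjoint W * A * W = four_block_mat (mat 1 1 (\<lambda>_. e)) (0\<^sub>m 1 m) (0\<^sub>m m 1) B"
proof -
  let ?n = "Suc m"
  from e have "eigenvalue A e" using eigenvalue_root_char_poly[OF A] by simp
  then obtain v where v: "v \<in> carrier_vec ?n" "v \<noteq> 0\<^sub>v ?n" "A *\<^sub>v v = e \<cdot>\<^sub>v v"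
    using A unfolding eigenvalue_def eigenvector_def by auto
  obtain W c where W: "W \<in> unitary_mats ?n" and W0: "col W 0 = c \<cdot>\<^sub>v v"
    using unitary_completion[OF v(1,2)] .
  note Wc = unitary_matsD[OF W]
  define A' where "A' = mat_adjoint W * A * W"
  have A': "A' \<in> carrier_mat ?n ?n" using Wc A by (auto simp: A'_def)
  have A'_herm: "mat_adjoint A' = A'"
    using mat_adjoint_congruence[of "mat_adjoint W" ?n A] Wc A herm by (simp add: A'_def)
  have "col A' 0 = mat_adjoint W *\<^sub>v (A *\<^sub>v col W 0)"
    using Wc A unfolding A'_def
    by (subst col_mult2[of _ ?n ?n _ ?n]) (auto intro!: assoc_mult_mat_vec col_carrier_vec)
  also have "A *\<^sub>v col W 0 = e \<cdot>\<^sub>v col W 0"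
    using v A by (simp add: W0 mult_mat_vec smult_smult_assoc mult.commute)
  also have "mat_adjoint W *\<^sub>v (e \<cdot>\<^sub>v col W 0) = e \<cdot>\<^sub>v (mat_adjoint W *\<^sub>v col W 0)"
    using Wc by (intro mult_mat_vec[of _ ?n ?n]) (auto intro: col_carrier_vec)
  also have "mat_adjoint W *\<^sub>v col W 0 = col (mat_adjoint W * W) 0"
    using Wc by (subst col_mult2[of _ ?n ?n _ ?n]) auto
  finally have col: "col A' 0 = e \<cdot>\<^sub>v unit_vec ?n 0" using Wc by simp
  have A'_col: "A' $$ (i, 0) = (if i = 0 then e else 0)" if "i < ?n" for i
    using arg_cong[OF col, of "\<lambda>x. x $ i"] that A' by auto
  have A'_conj: "A' $$ (i, j) = cnj (A' $$ (j, i))" if "i < ?n" "j < ?n" for i j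
    using arg_cong[OF A'_herm, of "\<lambda>x. x $$ (i, j)"] that A' by auto
  have A'_row: "A' $$ (0, i) = 0" if "i < ?n" "i \<noteq> 0" for i
    using A'_conj[of 0 i] A'_col[of i] that by auto
  define B where "B = mat m m (\<lambda>(i, j). A' $$ (Suc i, Suc j))"
  show thesis
  proof (rule that[OF W])
    show "B \<in> carrier_mat m m" by (simp add: B_def)
    show "mat_adjoint B = B"
      by (rule eq_matI) (auto simp: B_def A'_conj[symmetric])
    show "mat_adjoint W * A * W = four_block_mat (mat 1 1 (\<lambda>_. e)) (0\<^sub>m 1 m) (0\<^sub>m m 1) B"
      unfolding A'_def[symmetric] using A'
      by (intro eq_matI) (auto simp: B_def A'_col A'_row)
  qed
qed

lemma block_diagonal_mult:
  assumes "A \<in> carrier_mat k k" "A' \<in> carrier_mat k k" "B \<in> carrier_mat m m" "B' \<in> carrier_mat m m"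
  shows "four_block_mat A (0\<^sub>m k m) (0\<^sub>m m k) B * four_block_mat A' (0\<^sub>m k m) (0\<^sub>m m k) B'
    = four_block_mat (A * A') (0\<^sub>m k m) (0\<^sub>m m k) (B * B')"
  using assms by (subst mult_four_block_mat[of _ k k _ m _ m _ _ k _ m]) auto

text \<open>The list \<open>es\<close> fixes the order in which the eigenvalues appear on the diagonal, so a sorted
  diagonalisation comes for free. The induction deflates the head of the list: the remaining
  Hermitian block has characteristic polynomial \<open>\<Prod>e\<leftarrow>es. [:- e, 1:]\<close> for the tail \<open>es\<close>,
  because characteristic polynomials of block triangular matrices multiply.\<close>

theorem hermitian_spectral:
  fixes A :: "complex mat"
  assumes "A \<in> carrier_mat n n" "mat_adjoint A = A"
    and "char_poly A = (\<Prod>e\<leftarrow>es. [:- e, 1:])" "length es = n"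
  shows "\<exists>U \<in> unitary_mats n. A = U * mat_diag n (\<lambda>i. es ! i) * mat_adjoint U"
  using assms
proof (induction es arbitrary: n A)
  case Nil
  then show ?case by (intro bexI[of _ "1\<^sub>m 0"]) auto
next
  case (Cons e es)
  define m where "m = length es"
  have n: "n = Suc m" using Cons by (simp add: m_def)
  note A = Cons.prems(1)[unfolded n]
  have "poly (char_poly A) e = 0" using Cons.prems by simp
  then obtain W B where W: "W \<in> unitary_mats n" and B: "B \<in> carrier_mat m m" "mat_adjoint B = B"
    and WAW: "mat_adjoint W * A * W = four_block_mat (mat 1 1 (\<lambda>_. e)) (0\<^sub>m 1 m) (0\<^sub>m m 1) B"
    using hermitian_deflation[OF A Cons.prems(2)] n by blast
  note Wc = unitary_matsD[OF W]
  have "char_poly A = char_poly (mat_adjoint W * A * W)"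
    using char_poly_unitary_similar[OF unitary_mats_adjoint[OF W] Cons.prems(1)] by simp
  also have "\<dots> = char_poly (mat 1 1 (\<lambda>_. e)) * char_poly B"
    unfolding WAW by (rule char_poly_four_block_zeros_col) (use B in auto)
  also have "char_poly (mat 1 1 (\<lambda>_. e)) = [:- e, 1:]"
    by (simp add: char_poly_defs det_def sign_def)
  finally have "[:- e, 1:] * char_poly B = [:- e, 1:] * (\<Prod>e\<leftarrow>es. [:- e, 1:])"
    using Cons.prems by simp
  then have "char_poly B = (\<Prod>e\<leftarrow>es. [:- e, 1:])"
    by (metis mult_cancel_left pCons_eq_0_iff zero_neq_one)
  then obtain U' where U': "U' \<in> unitary_mats m"
    and BU: "B = U' * mat_diag m (\<lambda>i. es ! i) * mat_adjoint U'"
    using Cons.IH[OF B] m_def by blast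
  note U'c = unitary_matsD[OF U']
  define V where "V = four_block_mat (1\<^sub>m 1) (0\<^sub>m 1 m) (0\<^sub>m m 1) U'"
  define D where "D = mat_diag n (\<lambda>i. (e # es) ! i)"
  have Vc: "V \<in> carrier_mat n n" using U'c by (auto simp: V_def n)
  have V_adj: "mat_adjoint V = four_block_mat (1\<^sub>m 1) (0\<^sub>m 1 m) (0\<^sub>m m 1) (mat_adjoint U')"
    using U'c by (intro eq_matI) (auto simp: V_def)
  have D_block: "D = four_block_mat (mat 1 1 (\<lambda>_. e)) (0\<^sub>m 1 m) (0\<^sub>m m 1) (mat_diag m (\<lambda>i. es ! i))"
    by (rule eq_matI) (auto simp: D_def mat_diag_def n nth_Cons')
  have "mat_adjoint V * V = four_block_mat (1\<^sub>m 1) (0\<^sub>m 1 m) (0\<^sub>m m 1) (1\<^sub>m m)"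
    unfolding V_adj unfolding V_def
    using U'c by (subst block_diagonal_mult) auto
  then have V: "V \<in> unitary_mats n" using Vc n by (intro unitary_matsI) auto
  have Dc: "D \<in> carrier_mat n n" by (simp add: D_def)
  have "V * D * mat_adjoint V = mat_adjoint W * A * W"
    unfolding WAW V_adj D_block unfolding V_def BU
    using U'c by (subst block_diagonal_mult, auto)+
  then have "A = W * (V * D * mat_adjoint V) * mat_adjoint W"
    using Wc Cons.prems(1) W
    by (simp add: square_mult_assoc[of _ n] unitary_cancel_left)
  also have "\<dots> = (W * V) * D * mat_adjoint (W * V)"
    using Wc Vc Dc by (simp add: square_mult_assoc[of _ n] mat_adjoint_mult[of _ n n _ n])
  finally show ?case unfolding D_def using unitary_mats_mult[OF W V] by blast
qed


text \<open>A diagonal matrix unitarily similar to a Hermitian one is itself Hermitian, so its diagonal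
  is real.\<close>

lemma hermitian_eigenvalues_real:
  fixes A :: "complex mat"
  assumes A: "A \<in> carrier_mat n n" "mat_adjoint A = A"
    and cp: "char_poly A = (\<Prod>e\<leftarrow>es. [:- e, 1:])" "length es = n" and e: "e \<in> set es"
  shows "complex_of_real (Re e) = e"
proof -
  define D where "D = mat_diag n (\<lambda>i. es ! i)"
  obtain U where U: "U \<in> unitary_mats n" and AU: "A = U * D * mat_adjoint U"
    using hermitian_spectral[OF A cp] unfolding D_def by blast
  note Uc = unitary_matsD[OF U]
  have Dc: "D \<in> carrier_mat n n" by (simp add: D_def)
  have "D = mat_adjoint U * A * U"
    unfolding AU using Uc Dc U
    by (simp add: square_mult_assoc[of _ n] unitary_cancel_left)
  then have "mat_adjoint D = D"
    using mat_adjoint_congruence[of "mat_adjoint U" n A] Uc A by simp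
  moreover obtain i where i: "i < n" "e = es ! i" using e cp(2) by (metis in_set_conv_nth)
  ultimately have "D $$ (i, i) = cnj (D $$ (i, i))"
    using mat_adjoint_index[of i D i] Dc by simp
  then have "e = cnj e" using i by (simp add: D_def mat_diag_def)
  then show ?thesis by (simp add: complex_eq_iff)
qed

lemma ordered_eigenvalues_exist:
  fixes A :: "complex mat"
  assumes A: "A \<in> carrier_mat n n" "mat_adjoint A = A"
  shows "\<exists>x. ordered_eigenvalues A x"
proof -
  obtain es where cp: "char_poly A = (\<Prod>e\<leftarrow>es. [:- e, 1:])" and len: "length es = n"
    using char_poly_factorized[OF A(1)] by blast
  define rs where "rs = rev (sort (map Re es))"
  define x where "x = vec_of_list rs"
  have dim: "dim_vec x = n" by (simp add: x_def rs_def len)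
  have "sorted_wrt (\<ge>) rs" unfolding rs_def by (simp add: sorted_wrt_rev)
  then have mono: "x $ j \<le> x $ i" if "i \<le> j" "j < n" for i j
    using that len sorted_wrt_iff_nth_less[of "(\<ge>)" rs]
    by (cases "i = j") (auto simp: x_def rs_def vec_of_list_index)
  have "map (\<lambda>e. complex_of_real (Re e)) es = es"
    using hermitian_eigenvalues_real[OF A cp len] by (intro map_idI) auto
  then have "mset (map complex_of_real rs) = mset es"
    by (metis (mono_tags) rs_def comp_apply map_eq_conv map_map mset_map mset_rev mset_sort)
  then have "char_poly A = (\<Prod>e\<leftarrow>map complex_of_real rs. [:- e, 1:])"
    unfolding cp prod_mset_prod_list[symmetric] mset_map[of "\<lambda>e. [:- e, 1:]"] by (simp only:)
  also have "\<dots> = (\<Prod>i<n. [:- complex_of_real (x $ i), 1:])"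
    using len by (subst prod.list_conv_set_nth) (auto simp: x_def rs_def vec_of_list_index atLeast0LessThan)
  finally show ?thesis
    using dim mono A unfolding ordered_eigenvalues_def by (intro exI[of _ x]) auto
qed

lemma ordered_eigenvalues_diagonalise:
  fixes A :: "complex mat"
  assumes A: "A \<in> carrier_mat n n" "mat_adjoint A = A" and x: "ordered_eigenvalues A x"
  shows "\<exists>U \<in> unitary_mats n. A = U * real_diag x * mat_adjoint U"
proof -
  define es where "es = map (\<lambda>i. complex_of_real (x $ i)) [0..<n]"
  have dim: "dim_vec x = n" using x A by (simp add: ordered_eigenvalues_def)
  have "char_poly A = (\<Prod>i<n. [:- complex_of_real (x $ i), 1:])"
    using x dim by (simp add: ordered_eigenvalues_def)
  also have "\<dots> = (\<Prod>e\<leftarrow>es. [:- e, 1:])"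
    by (subst prod.list_conv_set_nth) (auto simp: es_def atLeast0LessThan)
  finally have "\<exists>U \<in> unitary_mats n. A = U * mat_diag n (\<lambda>i. es ! i) * mat_adjoint U"
    by (intro hermitian_spectral[OF A]) (auto simp: es_def)
  moreover have "mat_diag n (\<lambda>i. es ! i) = real_diag x"
    by (rule eq_matI) (auto simp: real_diag_def mat_diag_def es_def dim)
  ultimately show ?thesis by simp
qed

section \<open>Non-negativity of the trace functional\<close>

lemma nonneg_hermitian_matsD:
  assumes "\<Delta> \<in> nonneg_hermitian_mats n"
  shows "\<Delta> \<in> carrier_mat n n" "mat_adjoint \<Delta> = \<Delta>"
  using assms by (auto simp: nonneg_hermitian_mats_def)

text \<open>The quadratic form of \<open>A \<Delta> A\<^sup>*\<close> at \<open>v\<close> is the one of \<open>\<Delta>\<close> at \<open>A\<^sup>* v\<close>.\<close>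

lemma nonneg_hermitian_congruence:
  assumes D: "\<Delta> \<in> nonneg_hermitian_mats n" and A: "A \<in> carrier_mat n n"
  shows "A * \<Delta> * mat_adjoint A \<in> nonneg_hermitian_mats n"
proof -
  note Dc = nonneg_hermitian_matsD[OF D]
  have "0 \<le> Re ((A * \<Delta> * mat_adjoint A *\<^sub>v v) \<bullet>c v)" if v: "v \<in> carrier_vec n" for v
  proof -
    define w where "w = mat_adjoint A *\<^sub>v v"
    have w: "w \<in> carrier_vec n"
      unfolding w_def using A v by (intro mult_mat_vec_carrier) auto
    have "A * \<Delta> * mat_adjoint A *\<^sub>v v = A *\<^sub>v (\<Delta> *\<^sub>v w)"
      using A Dc v w by (simp add: w_def[symmetric] assoc_mult_mat_vec[of _ n n _ n])
    also have "\<dots> \<bullet>c v = (\<Delta> *\<^sub>v w) \<bullet>c w"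
      unfolding w_def using A Dc v w[unfolded w_def]
      by (intro mat_adjoint_mult_mat_vec mult_mat_vec_carrier) auto
    finally show ?thesis using D w by (simp add: nonneg_hermitian_mats_def)
  qed
  then show ?thesis
    using mat_adjoint_congruence[OF A Dc] A Dc by (auto simp: nonneg_hermitian_mats_def)
qed

text \<open>The diagonal entries are the values of the quadratic form at the unit vectors. Together with
  \<open>nonneg_hermitian_congruence\<close> this bounds the traces defining \<open>iota\<close> from below.\<close>

lemma nonneg_hermitian_trace:
  assumes D: "\<Delta> \<in> nonneg_hermitian_mats n"
  shows "0 \<le> Re (mat_trace \<Delta>)"
proof -
  note Dc = nonneg_hermitian_matsD[OF D]
  have "0 \<le> Re (\<Delta> $$ (i, i))" if i: "i < n" for i
  proof -
    have "conjugate (unit_vec n i :: complex vec) = unit_vec n i"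
      by (rule eq_vecI) (auto simp: unit_vec_def)
    then have "(\<Delta> *\<^sub>v unit_vec n i) \<bullet>c unit_vec n i = \<Delta> $$ (i, i)"
      using Dc i by (simp add: mult_mat_vec_def)
    then show ?thesis using D unfolding nonneg_hermitian_mats_def
      by (metis (mono_tags, lifting) mem_Collect_eq unit_vec_carrier)
  qed
  then show ?thesis using Dc by (auto simp: mat_trace_def intro!: sum_nonneg)
qed

lemma mat_trace_comm:
  assumes "A \<in> carrier_mat m n" "B \<in> carrier_mat n m"
  shows "mat_trace (A * B) = mat_trace (B * A)"
proof -
  have "mat_trace (A * B) = (\<Sum>i<m. \<Sum>j<n. A $$ (i, j) * B $$ (j, i))"
    using assms by (auto simp: mat_trace_def scalar_prod_def atLeast0LessThan intro!: sum.cong)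
  also have "\<dots> = (\<Sum>j<n. \<Sum>i<m. A $$ (i, j) * B $$ (j, i))"
    by (rule sum.swap)
  also have "\<dots> = mat_trace (B * A)"
    using assms by (auto simp: mat_trace_def scalar_prod_def atLeast0LessThan mult.commute intro!: sum.cong)
  finally show ?thesis .
qed

section \<open>How the infimum transforms under unitary matrices\<close>

lemma iota_congruence:
  assumes "\<A> \<subseteq> carrier_mat n n" "\<Delta> \<in> carrier_mat n n" "U \<in> carrier_mat n n"
  shows "iota (U * \<Delta> * mat_adjoint U) \<A> = iota \<Delta> ((\<lambda>A. A * U) ` \<A>)"
proof -
  have "A * (U * \<Delta> * mat_adjoint U) * mat_adjoint A = A * U * \<Delta> * mat_adjoint (A * U)"
    if "A \<in> carrier_mat n n" for A
    using assms that by (simp add: square_mult_assoc[of _ n] mat_adjoint_mult[of _ n n _ n])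
  then show ?thesis
    using assms(1) unfolding iota_def image_image
    by (intro arg_cong[of _ _ Inf] image_cong) auto
qed

lemma iota_unitary_left:
  assumes \<A>: "\<A> \<subseteq> carrier_mat n n" and D: "\<Delta> \<in> carrier_mat n n" and V: "V \<in> unitary_mats n"
  shows "iota \<Delta> ((\<lambda>A. V * A) ` \<A>) = iota \<Delta> \<A>"
proof -
  note Vc = unitary_matsD[OF V]
  have "mat_trace (V * A * \<Delta> * mat_adjoint (V * A)) = mat_trace (A * \<Delta> * mat_adjoint A)"
    if A: "A \<in> carrier_mat n n" for A
  proof -
    let ?M = "A * \<Delta> * mat_adjoint A"
    have M: "?M \<in> carrier_mat n n" using A D by auto
    have "V * A * \<Delta> * mat_adjoint (V * A) = V * ?M * mat_adjoint V"
      using A D Vc by (simp add: square_mult_assoc[of _ n] mat_adjoint_mult[of _ n n _ n])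
    also have "mat_trace \<dots> = mat_trace (mat_adjoint V * (V * ?M))"
      using M Vc by (intro mat_trace_comm[of _ n n]) auto
    also have "\<dots> = mat_trace ?M" using unitary_cancel_left[OF V M] by simp
    finally show ?thesis .
  qed
  then show ?thesis
    using \<A> unfolding iota_def image_image
    by (intro arg_cong[of _ _ Inf] image_cong) auto
qed

text \<open>Both kinds of weak invariance collapse to this one property: for similarity invariance,
  \<open>\<A> U\<close> and \<open>U\<^sup>* \<A> U = \<A>\<close> have the same infimum, since a left unitary factor does not change
  the traces.\<close>

lemma weakly_unitarily_invariant_iota:
  assumes inv: "weakly_unitarily_invariant n \<A>" and D: "\<Delta> \<in> carrier_mat n n"
    and U: "U \<in> unitary_mats n"
  shows "iota (U * \<Delta> * mat_adjoint U) \<A> = iota \<Delta> \<A>"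
proof -
  have \<A>: "\<A> \<subseteq> carrier_mat n n"
    using inv by (auto simp: weakly_unitarily_invariant_def right_unitarily_invariant_def
        unitary_similarity_invariant_def)
  note Uc = unitary_matsD[OF U]
  have cong: "iota (U * \<Delta> * mat_adjoint U) \<A> = iota \<Delta> ((\<lambda>A. A * U) ` \<A>)"
    by (rule iota_congruence[OF \<A> D Uc(1)])
  from inv consider "(\<lambda>A. A * U) ` \<A> = \<A>" | "(\<lambda>A. mat_adjoint U * A * U) ` \<A> = \<A>"
    using U by (auto simp: weakly_unitarily_invariant_def right_unitarily_invariant_def
        unitary_similarity_invariant_def)
  then show ?thesis
  proof cases
    case 1
    then show ?thesis using cong by simp
  next
    case 2
    have AU: "(\<lambda>A. A * U) ` \<A> \<subseteq> carrier_mat n n" using \<A> Uc by auto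
    have "(\<lambda>A. mat_adjoint U * A) ` (\<lambda>A. A * U) ` \<A> = (\<lambda>A. mat_adjoint U * A * U) ` \<A>"
      unfolding image_image using \<A> Uc
      by (intro image_cong) (auto simp: square_mult_assoc[of _ n] subset_iff)
    then show ?thesis
      using 2 cong iota_unitary_left[OF AU D unitary_mats_adjoint[OF U]] by simp
  qed
qed

section \<open>The unitarily invariant hull\<close>

definition unitary_hull :: "nat \<Rightarrow> complex mat set \<Rightarrow> complex mat set" where
  "unitary_hull n \<A> = {V * A * U | V A U. V \<in> unitary_mats n \<and> A \<in> \<A> \<and> U \<in> unitary_mats n}"

lemma unitary_hullI:
  "V \<in> unitary_mats n \<Longrightarrow> A \<in> \<A> \<Longrightarrow> U \<in> unitary_mats n \<Longrightarrow> V * A * U \<in> unitary_hull n \<A>"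
  by (auto simp: unitary_hull_def)

lemma subset_unitary_hull:
  assumes "\<A> \<subseteq> carrier_mat n n"
  shows "\<A> \<subseteq> unitary_hull n \<A>"
proof
  fix A assume "A \<in> \<A>"
  then show "A \<in> unitary_hull n \<A>"
    using unitary_hullI[of "1\<^sub>m n" n A \<A> "1\<^sub>m n"] assms by auto
qed

lemma unitarily_invariant_unitary_hull:
  assumes ne: "\<A> \<noteq> {}" and \<A>: "\<A> \<subseteq> carrier_mat n n"
  shows "unitarily_invariant n (unitary_hull n \<A>)"
proof -
  have closed: "V * B * U \<in> unitary_hull n \<A>"
    if "B \<in> unitary_hull n \<A>" and U: "U \<in> unitary_mats n" and V: "V \<in> unitary_mats n" for B U V
  proof -
    obtain V' A U' where B: "B = V' * A * U'" and V': "V' \<in> unitary_mats n"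
      and A: "A \<in> \<A>" and U': "U' \<in> unitary_mats n"
      using \<open>B \<in> unitary_hull n \<A>\<close> by (auto simp: unitary_hull_def)
    have "V * B * U = (V * V') * A * (U' * U)"
      using A \<A> unitary_matsD(1)[OF U] unitary_matsD(1)[OF V]
        unitary_matsD(1)[OF U'] unitary_matsD(1)[OF V']
      by (auto simp: B square_mult_assoc[of _ n] subset_iff)
    then show ?thesis
      using unitary_hullI[OF unitary_mats_mult[OF V V'] A unitary_mats_mult[OF U' U]] by simp
  qed
  have carrier: "unitary_hull n \<A> \<subseteq> carrier_mat n n"
    using \<A> by (force simp: unitary_hull_def dest: unitary_matsD(1))
  have "(\<lambda>B. V * B * U) ` unitary_hull n \<A> = unitary_hull n \<A>"
    if U: "U \<in> unitary_mats n" and V: "V \<in> unitary_mats n" for U V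
  proof (rule antisym; rule subsetI)
    fix B assume B: "B \<in> unitary_hull n \<A>"
    have Bc: "B \<in> carrier_mat n n" using B carrier by auto
    note Uc = unitary_matsD(1)[OF U] and Vc = unitary_matsD(1)[OF V]
    have "V * (mat_adjoint V * B * mat_adjoint U) * U = V * (mat_adjoint V * (B * mat_adjoint U * U))"
      using Bc Uc Vc by (simp add: square_mult_assoc[of _ n])
    also have "\<dots> = B"
      using Bc U V by (simp add: unitary_cancel_left unitary_cancel_right)
    finally show "B \<in> (\<lambda>B. V * B * U) ` unitary_hull n \<A>"
      using closed[OF B unitary_mats_adjoint[OF U] unitary_mats_adjoint[OF V]]
      by (intro image_eqI[of _ _ "mat_adjoint V * B * mat_adjoint U"]) auto
  qed (use closed U V in auto)
  then show ?thesis
    using ne carrier subset_unitary_hull[OF \<A>] by (auto simp: unitarily_invariant_def)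
qed

lemma iota_lower:
  assumes D: "\<Delta> \<in> nonneg_hermitian_mats n" and \<A>: "\<A> \<subseteq> carrier_mat n n" and A: "A \<in> \<A>"
  shows "iota \<Delta> \<A> \<le> Re (mat_trace (A * \<Delta> * mat_adjoint A))"
  unfolding iota_def
proof (rule cINF_lower[OF _ A])
  show "bdd_below ((\<lambda>A. Re (mat_trace (A * \<Delta> * mat_adjoint A))) ` \<A>)"
    using \<A> nonneg_hermitian_trace[OF nonneg_hermitian_congruence[OF D]]
    by (intro bdd_belowI[of _ 0]) auto
qed

text \<open>The hull contains \<open>\<A>\<close>, so its infimum can only be smaller. Conversely, the trace at
  \<open>V A U\<close> for \<open>\<Delta>\<close> equals the trace at \<open>A\<close> for \<open>U \<Delta> U\<^sup>*\<close>, which is bounded below by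
  the infimum of \<open>\<A>\<close> for \<open>U \<Delta> U\<^sup>*\<close>, that is, by the one for \<open>\<Delta>\<close>.\<close>

lemma iota_unitary_hull:
  assumes ne: "\<A> \<noteq> {}" and \<A>: "\<A> \<subseteq> carrier_mat n n" and D: "\<Delta> \<in> nonneg_hermitian_mats n"
    and inv: "\<And>U. U \<in> unitary_mats n \<Longrightarrow> iota (U * \<Delta> * mat_adjoint U) \<A> = iota \<Delta> \<A>"
  shows "iota \<Delta> (unitary_hull n \<A>) = iota \<Delta> \<A>"
proof (rule antisym)
  have hull: "unitary_hull n \<A> \<noteq> {}" "unitary_hull n \<A> \<subseteq> carrier_mat n n"
    using unitarily_invariant_unitary_hull[OF ne \<A>] by (auto simp: unitarily_invariant_def)
  show "iota \<Delta> (unitary_hull n \<A>) \<le> iota \<Delta> \<A>"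
    unfolding iota_def[of \<Delta> \<A>]
    using iota_lower[OF D hull(2)] subset_unitary_hull[OF \<A>] by (intro cINF_greatest[OF ne]) auto
  have "iota \<Delta> \<A> \<le> Re (mat_trace (B * \<Delta> * mat_adjoint B))" if hB: "B \<in> unitary_hull n \<A>" for B
  proof -
    obtain V A U where B: "B = V * A * U" and V: "V \<in> unitary_mats n"
      and A: "A \<in> \<A>" and U: "U \<in> unitary_mats n"
      using hB by (auto simp: unitary_hull_def)
    note Dc = nonneg_hermitian_matsD[OF D] and Uc = unitary_matsD(1)[OF U]
    have A1: "{A} \<subseteq> carrier_mat n n" and AU: "{A * U} \<subseteq> carrier_mat n n" using A \<A> Uc by auto
    let ?D = "U * \<Delta> * mat_adjoint U"
    \<comment> \<open>The trace at a single matrix is \<open>iota\<close> of a singleton, so the two transformation rules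
      for \<open>iota\<close> apply to it.\<close>
    have "iota \<Delta> \<A> = iota ?D \<A>" using inv[OF U] by simp
    also have "\<dots> \<le> Re (mat_trace (A * ?D * mat_adjoint A))"
      by (rule iota_lower[OF nonneg_hermitian_congruence[OF D Uc] \<A> A])
    also have "\<dots> = iota ?D {A}" by (simp add: iota_def)
    also have "\<dots> = iota \<Delta> {A * U}" using iota_congruence[OF A1 Dc(1) Uc] by simp
    also have "\<dots> = iota \<Delta> {V * (A * U)}" using iota_unitary_left[OF AU Dc(1) V] by simp
    also have "V * (A * U) = B"
      using A1 Uc unitary_matsD(1)[OF V] by (simp add: B square_mult_assoc[of _ n])
    also have "iota \<Delta> {B} = Re (mat_trace (B * \<Delta> * mat_adjoint B))" by (simp add: iota_def)
    finally show ?thesis .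
  qed
  then show "iota \<Delta> \<A> \<le> iota \<Delta> (unitary_hull n \<A>)"
    unfolding iota_def[of \<Delta> "unitary_hull n \<A>"] by (intro cINF_greatest[OF hull(1)]) auto
qed

section \<open>Spectral functions and unitary invariance\<close>

lemma iota_eq_g_fun:
  assumes "weakly_unitarily_invariant n \<A>" "\<Delta> \<in> nonneg_hermitian_mats n"
    "ordered_eigenvalues \<Delta> x"
  shows "iota \<Delta> \<A> = g_fun \<A> x"
proof -
  note Dc = nonneg_hermitian_matsD[OF assms(2)]
  obtain U where U: "U \<in> unitary_mats n" and D: "\<Delta> = U * real_diag x * mat_adjoint U"
    using ordered_eigenvalues_diagonalise[OF Dc assms(3)] by blast
  have "real_diag x \<in> carrier_mat n n"
    using assms(3) Dc by (auto simp: real_diag_def ordered_eigenvalues_def)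
  then show ?thesis
    unfolding g_fun_def D by (rule weakly_unitarily_invariant_iota[OF assms(1) _ U])
qed

text \<open>\<open>\<Delta>\<close> and \<open>U \<Delta> U\<^sup>*\<close> have a common list of ordered eigenvalues, and the hypothesis expresses
  both sides by it.\<close>

lemma iota_spectral_imp_conjugation_invariant:
  assumes spec: "\<forall>\<Delta> \<in> nonneg_hermitian_mats n. \<forall>x. ordered_eigenvalues \<Delta> x \<longrightarrow>
      iota \<Delta> \<A> = g_fun \<A> x"
    and D: "\<Delta> \<in> nonneg_hermitian_mats n" and U: "U \<in> unitary_mats n"
  shows "iota (U * \<Delta> * mat_adjoint U) \<A> = iota \<Delta> \<A>"
proof -
  note Dc = nonneg_hermitian_matsD[OF D] and Uc = unitary_matsD(1)[OF U]
  obtain x where x: "ordered_eigenvalues \<Delta> x" using ordered_eigenvalues_exist[OF Dc] by blast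
  have "ordered_eigenvalues (U * \<Delta> * mat_adjoint U) x"
    using x Dc Uc char_poly_unitary_similar[OF U Dc(1)] by (simp add: ordered_eigenvalues_def)
  then show ?thesis
    using spec nonneg_hermitian_congruence[OF D Uc] D x by simp
qed

theorem proposition3p6:
  fixes n :: nat
  assumes "n > 0"
  shows "(\<forall>\<A>. weakly_unitarily_invariant n \<A> \<longrightarrow>
            (\<forall>\<Delta> \<in> nonneg_hermitian_mats n. \<forall>x. ordered_eigenvalues \<Delta> x \<longrightarrow>
               iota \<Delta> \<A> = g_fun \<A> x)) \<and>
         (\<forall>\<A>. \<A> \<noteq> {} \<longrightarrow> \<A> \<subseteq> carrier_mat n n \<longrightarrow>
            (\<forall>\<Delta> \<in> nonneg_hermitian_mats n. \<forall>x. ordered_eigenvalues \<Delta> x \<longrightarrow>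
               iota \<Delta> \<A> = g_fun \<A> x) \<longrightarrow>
            (\<exists>\<A>'. unitarily_invariant n \<A>' \<and>
               (\<forall>\<Delta> \<in> nonneg_hermitian_mats n. iota \<Delta> \<A> = iota \<Delta> \<A>')))"
proof (intro conjI allI ballI impI)
  fix \<A> \<Delta> x
  assume "weakly_unitarily_invariant n \<A>" "\<Delta> \<in> nonneg_hermitian_mats n"
    "ordered_eigenvalues \<Delta> x"
  then show "iota \<Delta> \<A> = g_fun \<A> x" by (rule iota_eq_g_fun)
next
  fix \<A> :: "complex mat set"
  assume \<A>: "\<A> \<noteq> {}" "\<A> \<subseteq> carrier_mat n n"
    and spec: "\<forall>\<Delta> \<in> nonneg_hermitian_mats n. \<forall>x. ordered_eigenvalues \<Delta> x \<longrightarrow>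
      iota \<Delta> \<A> = g_fun \<A> x"
  have "iota \<Delta> \<A> = iota \<Delta> (unitary_hull n \<A>)" if "\<Delta> \<in> nonneg_hermitian_mats n" for \<Delta>
    using iota_unitary_hull[OF \<A> that iota_spectral_imp_conjugation_invariant[OF spec that]] by simp
  then show "\<exists>\<A>'. unitarily_invariant n \<A>' \<and>
      (\<forall>\<Delta> \<in> nonneg_hermitian_mats n. iota \<Delta> \<A> = iota \<Delta> \<A>')"
    using unitarily_invariant_unitary_hull[OF \<A>] by blast
qed

end
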